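(* Let $F\in\mathcal{F}$ and $t_0>0$. If $F$ admits phase transition at $t_0$ then $t_0$ is critical for $F$.
   Context: $\mathcal{F}$ is the set of rational functions $F(w)=wP(w)/Q(w)$, where $P,Q\in\mathbb{R}[w]$ are relatively prime polynomials with $P(0)=Q(0)=1$. For $t\in\mathbb{R}$ put \[ F^{\boxplus t}(w)=\frac{wP(w)}{P(w)+t\big(Q(w)-P(w)\big)}\in\mathcal{F}. \] The characteristic polynomial of $F=wP/Q\in\mathcal{F}$ is $\chi_F(w)=\big(P(w)+wP'(w)\big)Q(w)-wP(w)Q'(w)$, and $\mathcal{F}_{\mathrm{rr}}^{0}$ is the set of $F\in\mathcal{F}$ such that all complex roots of $\chi_F$ are real. For fixed $F$, $\chi_t$ denotes the characteristic polynomial of $F^{\boxplus t}$. $F$ admits phase transition at $t_0>0$ if $F^{\boxplus t_0}\in\mathcal{F}_{\mathrm{rr}}^{0}$ and there is $\delta>0$ such that either $F^{\boxplus t}\notin\mathcal{F}_{\mathrm{rr}}^{0}$ for all $t\in(t_0-\delta,t_0)$, or $F^{\boxplus t}\notin\mathcal{F}_{\mathrm{rr}}^{0}$ for all $t\in(t_0,t_0+\delta)$. $t_0>0$ is critical for $F$ if either $\chi_{t_0}(w)$ has a multiple real root or $\deg\chi_{t_0}(w)\le\deg\chi_t(w)-2$ for all $t\in\mathbb{R}\setminus\{0,t_0\}$. *)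

theory Defs
  imports Complex_Main "HOL-Computational_Algebra.Computational_Algebra"
    "HOL-Computational_Algebra.Field_as_Ring"
begin

text \<open>
  Rational functions are elements of the field of fractions of the polynomial ring over the reals;
  \<open>pCons 0 P\<close> is the polynomial \<open>w P(w)\<close>.
\<close>

definition reduced_form :: "real poly fract \<Rightarrow> real poly \<Rightarrow> real poly \<Rightarrow> bool" where
  "reduced_form F P Q \<longleftrightarrow>
     coprime P Q \<and> poly P 0 = 1 \<and> poly Q 0 = 1 \<and> F = to_fract (pCons 0 P) / to_fract Q"

definition ratF :: "real poly fract set" where
  "ratF = {F. \<exists>P Q. reduced_form F P Q}"

lemma reduced_form_unique:
  assumes "reduced_form F P Q" "reduced_form F P' Q'"
  shows "P = P' \<and> Q = Q'"
proof -
  have nz: "P \<noteq> 0" "P' \<noteq> 0" "Q \<noteq> 0" "Q' \<noteq> 0"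
    using assms by (auto simp: reduced_form_def)
  have "to_fract (pCons 0 P) / to_fract Q = to_fract (pCons 0 P') / to_fract Q'"
    using assms by (simp add: reduced_form_def)
  hence "to_fract (pCons 0 P * Q') = to_fract (pCons 0 P' * Q)"
    using nz by (simp add: frac_eq_eq del: mult_pCons_left)
  hence eq: "P * Q' = P' * Q"
    by (simp only: to_fract_eq_iff) simp
  have "P dvd P' * Q" "P' dvd P * Q'"
    using eq by (metis dvd_triv_left)+
  moreover have "coprime P Q" "coprime P' Q'"
    using assms by (auto simp: reduced_form_def)
  ultimately have dvd: "P dvd P'" "P' dvd P"
    using coprime_dvd_mult_left_iff[of P Q P'] coprime_dvd_mult_left_iff[of P' Q' P] by simp_all
  then obtain c where c: "P' = P * c"
    by (auto elim: dvdE)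
  hence "c dvd 1"
    using dvd(2) nz dvd_mult_cancel_left[of P c 1] by simp
  then obtain a where a: "c = [:a:]"
    by (auto simp: is_unit_poly_iff)
  have "a = 1"
    using assms c a by (simp add: reduced_form_def)
  hence "P' = P"
    using c a by (simp add: one_pCons)
  thus ?thesis
    using eq nz by simp
qed

definition reduced_pair :: "real poly fract \<Rightarrow> real poly \<times> real poly" where
  "reduced_pair F = (THE (P, Q). reduced_form F P Q)"

lemma reduced_pair_eq:
  assumes "reduced_form F P Q"
  shows "reduced_pair F = (P, Q)"
  unfolding reduced_pair_def
  by (rule the_equality) (use assms reduced_form_unique in auto)

definition boxplus_power :: "real poly fract \<Rightarrow> real \<Rightarrow> real poly fract" where
  "boxplus_power F t = (case reduced_pair F of (P, Q) \<Rightarrow>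
     to_fract (pCons 0 P) / to_fract (P + smult t (Q - P)))"

text \<open>
  For \<open>t \<noteq> 0\<close> the displayed fraction is already reduced. For \<open>t = 0\<close> it cancels to \<open>w\<close>, so that
  the reduced form is \<open>P = Q = 1\<close>.
\<close>

lemma boxplus_power_reduced:
  assumes "reduced_form F P Q" "t \<noteq> 0"
  shows "reduced_form (boxplus_power F t) P (P + smult t (Q - P))"
proof -
  have *: "smult t Q = (P + smult t (Q - P)) - smult (1 - t) P"
    by (rule poly_eqI) (simp add: algebra_simps)
  have "coprime P (P + smult t (Q - P))"
  proof (rule coprimeI)
    fix c assume c: "c dvd P" "c dvd P + smult t (Q - P)"
    hence "c dvd smult t Q"
      unfolding * by (intro dvd_diff dvd_smult)
    hence "c dvd Q"
      using assms(2) by (simp add: dvd_smult_iff)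
    with c show "c dvd 1"
      using assms(1) coprime_common_divisor by (auto simp: reduced_form_def)
  qed
  thus ?thesis
    unfolding boxplus_power_def reduced_pair_eq[OF assms(1)]
    using assms by (simp add: reduced_form_def)
qed

lemma boxplus_power_0:
  assumes "reduced_form F P Q"
  shows "reduced_form (boxplus_power F 0) 1 1"
proof -
  have "P \<noteq> 0"
    using assms by (auto simp: reduced_form_def)
  moreover have "pCons 0 P = pCons 0 1 * P"
    by simp
  ultimately have "to_fract (pCons 0 P) / to_fract P = to_fract (pCons 0 1)"
    by (simp only: to_fract_mult) simp
  thus ?thesis
    by (simp add: reduced_form_def boxplus_power_def reduced_pair_eq[OF assms])
qed

lemma boxplus_power_in_ratF: "F \<in> ratF \<Longrightarrow> boxplus_power F t \<in> ratF"
  unfolding ratF_def using boxplus_power_reduced boxplus_power_0 by (cases "t = 0") blast+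

definition chi :: "real poly fract \<Rightarrow> real poly" where
  "chi F = (case reduced_pair F of (P, Q) \<Rightarrow>
     (P + pCons 0 (pderiv P)) * Q - pCons 0 P * pderiv Q)"

text \<open>The polynomial \<open>chi F\<close> has value 1 at 0, hence is nonzero, for \<open>F \<in> ratF\<close>.\<close>

lemma poly_chi_0: "F \<in> ratF \<Longrightarrow> poly (chi F) 0 = 1"
  by (auto simp: ratF_def chi_def reduced_pair_eq reduced_form_def)

definition ratF_rr0 :: "real poly fract set" where
  "ratF_rr0 = {F \<in> ratF. \<forall>z::complex. poly (map_poly complex_of_real (chi F)) z = 0 \<longrightarrow> z \<in> \<real>}"

definition admits_phase_transition :: "real poly fract \<Rightarrow> real \<Rightarrow> bool" where
  "admits_phase_transition F t0 \<longleftrightarrow> t0 > 0 \<and>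
     boxplus_power F t0 \<in> ratF_rr0 \<and>
     (\<exists>\<delta>>0. (\<forall>t\<in>{t0 - \<delta><..<t0}. boxplus_power F t \<notin> ratF_rr0) \<or>
            (\<forall>t\<in>{t0<..<t0 + \<delta>}. boxplus_power F t \<notin> ratF_rr0))"

text \<open>The inequality \<open>deg \<chi>\<^sub>t\<^sub>0 \<le> deg \<chi>\<^sub>t - 2\<close> is written additively to avoid truncated subtraction.\<close>

definition critical :: "real poly fract \<Rightarrow> real \<Rightarrow> bool" where
  "critical F t0 \<longleftrightarrow> t0 > 0 \<and>
     ((\<exists>x::real. order x (chi (boxplus_power F t0)) \<ge> 2) \<or>
      (\<forall>t. t \<notin> {0, t0} \<longrightarrow>
         degree (chi (boxplus_power F t0)) + 2 \<le> degree (chi (boxplus_power F t))))"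

end

theory Submission
  imports Defs
begin

text \<open>
  For \<open>t \<noteq> 0\<close> the characteristic polynomial \<open>\<chi>\<^sub>t = P\<^sup>2 + t (\<chi>\<^sub>F - P\<^sup>2)\<close> is affine in \<open>t\<close>. Suppose
  that \<open>\<chi>\<^sub>t\<^sub>0\<close> is real-rooted but \<open>t\<^sub>0\<close> is not critical. Then \<open>\<chi>\<^sub>t\<^sub>0\<close> has \<open>n = deg \<chi>\<^sub>t\<^sub>0\<close> simple real
  roots, each of which persists as a sign change of \<open>\<chi>\<^sub>t\<close> for \<open>t\<close> near \<open>t\<^sub>0\<close>, while \<open>deg \<chi>\<^sub>t \<le> n + 1\<close>.
  Non-real roots come in conjugate pairs, so there is no room for them, and \<open>t\<^sub>0\<close> is not a phase
  transition.
\<close>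

section \<open>Real polynomials viewed over the complex numbers, and counts of their roots\<close>

lemma poly_map_of_real:
  "poly (map_poly of_real p) (of_real x :: 'a :: {real_algebra_1, comm_ring_1}) = of_real (poly p x)"
  by (induction p) (simp_all add: map_poly_pCons)

lemma poly_map_of_real_cnj:
  "poly (map_poly complex_of_real p) (cnj z) = cnj (poly (map_poly complex_of_real p) z)"
  by (induction p) (simp_all add: map_poly_pCons)

lemma pderiv_map_of_real:
  "pderiv (map_poly complex_of_real p) = map_poly complex_of_real (pderiv p)"
  by (rule poly_eqI) (simp add: coeff_pderiv coeff_map_poly)

lemma degree_map_of_real [simp]:
  "degree (map_poly complex_of_real p) = degree p"
  by (simp add: degree_map_poly)

lemma card_roots_eq_degree_complex:
  fixes p :: "complex poly"
  assumes "rsquarefree p"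
  shows "card {z. poly p z = 0} = degree p"
proof -
  have "p \<noteq> 0"
    using assms by (simp add: rsquarefree_def)
  have "degree p = (\<Sum>z | poly p z = 0. order z p)"
    using \<open>p \<noteq> 0\<close> by (simp flip: size_proots_complex add: size_multiset_overloaded_eq)
  also have "\<dots> = (\<Sum>z | poly p z = 0. 1)"
    using assms \<open>p \<noteq> 0\<close> by (intro sum.cong) (auto simp: rsquarefree_root_order)
  finally show ?thesis
    by simp
qed

text \<open>For a real polynomial \<open>rsquarefree\<close> constrains real roots only: the square
  of x^2 + 1 satisfies it. The second hypothesis makes every complex root real, so simplicity
  carries over to the complex polynomial, where simple roots are counted by the degree.\<close>

lemma card_real_roots_eq_degree:
  fixes p :: "real poly"
  assumes "rsquarefree p"
    and real: "\<And>z. poly (map_poly complex_of_real p) z = 0 \<Longrightarrow> z \<in> \<real>"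
  shows "card {x. poly p x = 0} = degree p"
proof -
  let ?p = "map_poly complex_of_real p"
  have "rsquarefree ?p"
    unfolding rsquarefree_roots
  proof safe
    fix z assume z: "poly ?p z = 0" "poly (pderiv ?p) z = 0"
    then obtain x where x: "z = of_real x"
      using real by (auto elim: Reals_cases)
    have "poly p x = 0" "poly (pderiv p) x = 0"
      using z by (simp_all add: x pderiv_map_of_real poly_map_of_real)
    thus False
      using \<open>rsquarefree p\<close> by (auto simp: rsquarefree_roots)
  qed
  hence "card {z. poly ?p z = 0} = degree p"
    using card_roots_eq_degree_complex by fastforce
  moreover have "{z. poly ?p z = 0} = of_real ` {x. poly p x = 0}"
    using real by (fastforce simp: poly_map_of_real elim!: Reals_cases)
  ultimately show ?thesis
    by (simp add: card_image inj_on_def)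
qed

text \<open>A non-real root comes with its conjugate, adding two to the number of distinct real
  roots, while the degree leaves room for only one more.\<close>

lemma all_roots_real_if_many_real_roots:
  fixes p :: "real poly"
  assumes "p \<noteq> 0" and deg: "degree p \<le> card {x. poly p x = 0} + 1"
    and z: "poly (map_poly complex_of_real p) z = 0"
  shows "z \<in> \<real>"
proof (rule ccontr)
  let ?p = "map_poly complex_of_real p"
  let ?R = "complex_of_real ` {x. poly p x = 0}"
  assume nz: "z \<notin> \<real>"
  have "?p \<noteq> 0"
    using \<open>p \<noteq> 0\<close> by (simp add: map_poly_eq_0_iff)
  hence fin: "finite {z. poly ?p z = 0}" and "card {z. poly ?p z = 0} \<le> degree p"
    using poly_roots_finite card_poly_roots_bound[of ?p] by auto
  moreover have "?R \<union> {z, cnj z} \<subseteq> {z. poly ?p z = 0}"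
    using z by (auto simp: poly_map_of_real poly_map_of_real_cnj)
  ultimately have "card (?R \<union> {z, cnj z}) \<le> degree p"
    using card_mono[OF fin] le_trans by blast
  moreover have "card (?R \<union> {z, cnj z}) = card ?R + card {z, cnj z}"
    using nz poly_roots_finite[OF \<open>p \<noteq> 0\<close>]
    by (intro card_Un_disjoint) (auto simp: complex_eq_iff complex_is_Real_iff)
  moreover have "card {z, cnj z} = 2"
    using nz by (auto simp: Reals_cnj_iff)
  moreover have "card ?R = card {x. poly p x = 0}"
    by (simp add: card_image inj_on_def)
  ultimately show False
    using deg by simp
qed

section \<open>Persistence of simple real roots under small perturbations\<close>

lemma sign_change_at_simple_root:
  fixes p :: "real poly"
  assumes "poly p x = 0" "poly (pderiv p) x \<noteq> 0" "e > 0"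
  obtains h where "0 < h" "h < e" "poly p (x - h) * poly p (x + h) < 0"
proof (cases "poly (pderiv p) x > 0")
  case True
  obtain d1 where d1: "d1 > 0" "\<And>h. h > 0 \<Longrightarrow> h < d1 \<Longrightarrow> poly p x < poly p (x + h)"
    using DERIV_pos_inc_right[OF poly_DERIV True] by blast
  obtain d2 where d2: "d2 > 0" "\<And>h. h > 0 \<Longrightarrow> h < d2 \<Longrightarrow> poly p (x - h) < poly p x"
    using DERIV_pos_inc_left[OF poly_DERIV True] by blast
  obtain h where "0 < h" "h < min e (min d1 d2)"
    using dense[of 0 "min e (min d1 d2)"] d1 d2 assms by auto
  thus ?thesis
    using that[of h] d1(2)[of h] d2(2)[of h] assms(1) by (simp add: mult_neg_pos)
next
  case False
  hence neg: "poly (pderiv p) x < 0"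
    using assms(2) by simp
  obtain d1 where d1: "d1 > 0" "\<And>h. h > 0 \<Longrightarrow> h < d1 \<Longrightarrow> poly p x > poly p (x + h)"
    using DERIV_neg_dec_right[OF poly_DERIV neg] by blast
  obtain d2 where d2: "d2 > 0" "\<And>h. h > 0 \<Longrightarrow> h < d2 \<Longrightarrow> poly p (x - h) > poly p x"
    using DERIV_neg_dec_left[OF poly_DERIV neg] by blast
  obtain h where "0 < h" "h < min e (min d1 d2)"
    using dense[of 0 "min e (min d1 d2)"] d1 d2 assms by auto
  thus ?thesis
    using that[of h] d1(2)[of h] d2(2)[of h] assms(1) by (simp add: mult_pos_neg)
qed

text \<open>Opposite signs at two fixed points around \<open>x\<close> are an open condition on
  \<open>s\<close>; the intermediate value theorem then gives a root between them.\<close>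

lemma eventually_root_near_simple_root:
  fixes p q :: "real poly"
  assumes "poly p x = 0" "poly (pderiv p) x \<noteq> 0" "e > 0"
  shows "\<forall>\<^sub>F s in nhds 0. \<exists>y. \<bar>y - x\<bar> < e \<and> poly (p + smult s q) y = 0"
proof -
  obtain h where h: "0 < h" "h < e" "poly p (x - h) * poly p (x + h) < 0"
    using sign_change_at_simple_root[OF assms] .
  let ?g = "\<lambda>s. poly (p + smult s q) (x - h) * poly (p + smult s q) (x + h)"
  have "(?g \<longlongrightarrow> ?g 0) (nhds 0)"
    by (auto intro!: tendsto_eq_intros filterlim_ident)
  hence "\<forall>\<^sub>F s in nhds 0. ?g s < 0"
    by (rule order_tendstoD) (use h in simp)
  thus ?thesis
  proof eventually_elim
    case (elim s)
    then obtain y where "x - h < y" "y < x + h" "poly (p + smult s q) y = 0"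
      using poly_IVT[of "x - h" "x + h" "p + smult s q"] h by auto
    thus ?case
      using h by (intro exI[of _ y]) auto
  qed
qed

lemma finite_set_separated:
  fixes A :: "real set"
  assumes "finite A"
  obtains e where "e > 0" "\<And>x y. x \<in> A \<Longrightarrow> y \<in> A \<Longrightarrow> \<bar>x - y\<bar> < e \<Longrightarrow> x = y"
proof -
  \<comment> \<open>The element 1 keeps the set nonempty when \<open>A\<close> has fewer than two
    points, so that \<open>Min\<close> is meaningful.\<close>
  let ?D = "insert 1 ((\<lambda>(x, y). \<bar>x - y\<bar>) ` {(x, y) \<in> A \<times> A. x \<noteq> y})"
  have "finite {(x, y) \<in> A \<times> A. x \<noteq> y}"
    using assms by (auto intro: finite_subset[of _ "A \<times> A"])
  hence fin: "finite ?D"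
    by blast
  show ?thesis
  proof (rule that[of "Min ?D"])
    show "Min ?D > 0"
      using fin by (subst Min_gr_iff) auto
    show "x = y" if "x \<in> A" "y \<in> A" "\<bar>x - y\<bar> < Min ?D" for x y
    proof (rule ccontr)
      assume "x \<noteq> y"
      hence "Min ?D \<le> \<bar>x - y\<bar>"
        using that fin by (intro Min_le) auto
      thus False
        using that by simp
    qed
  qed
qed

lemma eventually_card_real_roots_ge:
  fixes p q :: "real poly"
  assumes "rsquarefree p"
  shows "\<forall>\<^sub>F s in nhds 0. p + smult s q \<noteq> 0 \<and>
           card {x. poly p x = 0} \<le> card {x. poly (p + smult s q) x = 0}"
proof -
  let ?A = "{x. poly p x = 0}"
  have "p \<noteq> 0"
    using assms by (simp add: rsquarefree_def)
  hence fin: "finite ?A"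
    by (rule poly_roots_finite)
  obtain e where e: "e > 0" "\<And>x y. x \<in> ?A \<Longrightarrow> y \<in> ?A \<Longrightarrow> \<bar>x - y\<bar> < e \<Longrightarrow> x = y"
    using finite_set_separated[OF fin] by blast
  \<comment> \<open>The radius \<open>e / 2\<close> ensures that one point cannot be close to two
    different roots of \<open>p\<close>, so the choice of nearby roots below is injective.\<close>
  have "\<forall>\<^sub>F s in nhds 0. \<forall>x\<in>?A. \<exists>y. \<bar>y - x\<bar> < e / 2 \<and> poly (p + smult s q) y = 0"
    using assms e(1)
    by (intro eventually_ball_finite[OF fin] ballI eventually_root_near_simple_root)
       (auto simp: rsquarefree_roots)
  \<comment> \<open>A nonzero perturbed polynomial has finitely many roots, without which its
    \<open>card\<close> would not bound anything.\<close>
  moreover have "\<forall>\<^sub>F s in nhds 0. p + smult s q \<noteq> 0"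
  proof -
    obtain x where x: "poly p x \<noteq> 0"
      using \<open>p \<noteq> 0\<close> poly_all_0_iff_0 by blast
    have "((\<lambda>s. poly (p + smult s q) x) \<longlongrightarrow> poly p x) (nhds 0)"
      by (auto intro!: tendsto_eq_intros filterlim_ident)
    hence "\<forall>\<^sub>F s in nhds 0. poly (p + smult s q) x \<noteq> 0"
      using x by (rule tendsto_imp_eventually_ne)
    thus ?thesis
      by eventually_elim (metis poly_0)
  qed
  ultimately show ?thesis
  proof eventually_elim
    case (elim s)
    then obtain f where f: "\<And>x. x \<in> ?A \<Longrightarrow> \<bar>f x - x\<bar> < e / 2 \<and> poly (p + smult s q) (f x) = 0"
      by metis
    have "inj_on f ?A"
    proof (rule inj_onI)
      fix x y assume xy: "x \<in> ?A" "y \<in> ?A" "f x = f y"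
      hence "\<bar>x - y\<bar> < e"
        using f[OF xy(1)] f[OF xy(2)] by linarith
      thus "x = y"
        using e(2) xy by blast
    qed
    moreover have "f ` ?A \<subseteq> {x. poly (p + smult s q) x = 0}"
      using f by blast
    ultimately show ?case
      using elim poly_roots_finite card_inj_on_le by blast
  qed
qed

text \<open>The perturbation may raise the degree by one, but the \<open>degree p\<close> simple
  real roots survive, and the one remaining place cannot hold a conjugate pair.\<close>

lemma eventually_all_roots_real:
  fixes p q :: "real poly"
  assumes "rsquarefree p"
    and "\<And>z. poly (map_poly complex_of_real p) z = 0 \<Longrightarrow> z \<in> \<real>"
    and "degree q \<le> degree p + 1"
  shows "\<forall>\<^sub>F s in nhds 0. \<forall>z. poly (map_poly complex_of_real (p + smult s q)) z = 0 \<longrightarrow> z \<in> \<real>"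
  using eventually_card_real_roots_ge[OF assms(1), of q]
proof eventually_elim
  case (elim s)
  have "degree (p + smult s q) \<le> degree p + 1"
    using assms(3) degree_smult_le[of s q] by (intro degree_add_le) auto
  hence "degree (p + smult s q) \<le> card {x. poly (p + smult s q) x = 0} + 1"
    using elim card_real_roots_eq_degree[OF assms(1,2)] by simp
  thus ?case
    using elim all_roots_real_if_many_real_roots by blast
qed

text \<open>For \<open>t = 0\<close> the identity fails unless \<open>P = 1\<close>, since \<open>chi (boxplus_power F 0) = 1\<close>.\<close>

lemma chi_boxplus_power:
  assumes "reduced_form F P Q" "t \<noteq> 0"
  shows "chi (boxplus_power F t) = P\<^sup>2 + smult t (chi F - P\<^sup>2)"
proof (rule poly_ext)
  fix x
  show "poly (chi (boxplus_power F t)) x = poly (P\<^sup>2 + smult t (chi F - P\<^sup>2)) x"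
    \<comment> \<open>In the part free of \<open>t\<close>, the two terms w P P' cancel and leave
      \<open>P\<^sup>2\<close>; the same cancellation occurs in the coefficient of
      \<open>t\<close>.\<close>
    unfolding chi_def reduced_pair_eq[OF assms(1)]
      reduced_pair_eq[OF boxplus_power_reduced[OF assms]] prod.case
      poly_add poly_diff poly_mult poly_smult poly_pCons poly_power
      pderiv_add pderiv_diff pderiv_smult power2_eq_square
    by algebra
qed

theorem corollary2p20:
  fixes F :: "real poly fract" and t0 :: real
  assumes "F \<in> ratF" and "t0 > 0"
    and "admits_phase_transition F t0"
  shows "critical F t0"
proof (rule ccontr)
  assume "\<not> critical F t0"
  then obtain t1 where simple: "\<And>x. order x (chi (boxplus_power F t0)) < 2"
    and t1: "t1 \<noteq> 0" "t1 \<noteq> t0"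
    and deg_t1: "degree (chi (boxplus_power F t1)) \<le> degree (chi (boxplus_power F t0)) + 1"
    using \<open>t0 > 0\<close> unfolding critical_def by (fastforce simp: not_le)
  obtain P Q where PQ: "reduced_form F P Q"
    using assms(1) by (auto simp: ratF_def)
  define p where "p = chi (boxplus_power F t0)"
  define q where "q = chi F - P\<^sup>2"
  have shift: "chi (boxplus_power F t) = p + smult (t - t0) q" if "t \<noteq> 0" for t
    using \<open>t0 > 0\<close> that
    by (simp add: p_def q_def chi_boxplus_power[OF PQ] smult_diff_left)
  have "p \<noteq> 0"
    using poly_chi_0[OF boxplus_power_in_ratF[OF assms(1), of t0]] by (auto simp: p_def)
  hence "rsquarefree p"
    using simple by (auto simp: rsquarefree_def p_def less_2_cases_iff)
  moreover have "z \<in> \<real>" if "poly (map_poly complex_of_real p) z = 0" for z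
    using assms(3) that by (auto simp: admits_phase_transition_def ratF_rr0_def p_def)
  \<comment> \<open>By affinity in \<open>t\<close>, \<open>q\<close> is a nonzero multiple of the
    difference of the characteristic polynomials at \<open>t1\<close> and \<open>t0\<close>, so the
    single parameter \<open>t1\<close> controls the degree for all \<open>t\<close>.\<close>
  moreover have "degree q \<le> degree p + 1"
  proof -
    have "smult (t1 - t0) q = chi (boxplus_power F t1) - p"
      using shift[OF t1(1)] by simp
    hence "degree (smult (t1 - t0) q) \<le> degree p + 1"
      using deg_t1 by (auto intro: degree_diff_le simp: p_def)
    thus ?thesis
      using t1 by simp
  qed
  ultimately have "\<forall>\<^sub>F s in nhds 0. \<forall>z. poly (map_poly complex_of_real (p + smult s q)) z = 0 \<longrightarrow> z \<in> \<real>"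
    by (rule eventually_all_roots_real)
  then obtain e where e: "e > 0"
    "\<And>s z. \<bar>s\<bar> < e \<Longrightarrow> poly (map_poly complex_of_real (p + smult s q)) z = 0 \<Longrightarrow> z \<in> \<real>"
    by (auto simp: eventually_nhds_metric dist_real_def)
  \<comment> \<open>Positivity of \<open>t\<close> excludes 0, where the affine formula may
    fail.\<close>
  have rr: "boxplus_power F t \<in> ratF_rr0" if "t > 0" "\<bar>t - t0\<bar> < e" for t
    using that e(2)[of "t - t0"] boxplus_power_in_ratF[OF assms(1)] shift[of t]
    by (auto simp: ratF_rr0_def)
  obtain d where "d > 0"
    and d: "(\<forall>t\<in>{t0 - d<..<t0}. boxplus_power F t \<notin> ratF_rr0) \<or>
            (\<forall>t\<in>{t0<..<t0 + d}. boxplus_power F t \<notin> ratF_rr0)"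
    using assms(3) by (auto simp: admits_phase_transition_def)
  \<comment> \<open>Taking \<open>h\<close> below \<open>t0\<close> keeps \<open>t0 - h\<close>
    positive, below \<open>d\<close> puts \<open>t0 - h\<close> and \<open>t0 + h\<close> in the two
    one-sided intervals, and below \<open>e\<close> makes \<open>rr\<close> apply; both alternatives
    fail at once.\<close>
  obtain h where h: "0 < h" "h < min t0 (min d e)"
    using dense[of 0 "min t0 (min d e)"] \<open>t0 > 0\<close> \<open>d > 0\<close> \<open>e > 0\<close> by auto
  have "t0 - h \<in> {t0 - d<..<t0}" "t0 + h \<in> {t0<..<t0 + d}"
    using h by auto
  moreover have "boxplus_power F (t0 - h) \<in> ratF_rr0" "boxplus_power F (t0 + h) \<in> ratF_rr0"
    using h \<open>t0 > 0\<close> by (auto intro!: rr)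
  ultimately show False
    using d by blast
qed

end
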